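(* Let $\mathbf{P}=\{p_n(x)\}_{n\ge 0}$ be a sequence of complex polynomials with $\deg p_n(x)=n$ and $p_0(x)=1$. Define $T_2(n,k;\mathbf{P})$ by $p_n(x)=\sum_{k=0}^{n}T_2(n,k;\mathbf{P})\,x^{[k]}$. Then for $0\le k\le n$, $$T_2(n,k;\mathbf{P})=\sum_{l=k}^{n}S_2(l,k)\,\frac{1}{l!}\Big(\frac{d}{dx}\Big)^{l}p_n(x)\Big|_{x=-k/2}.$$
   Context: Central factorials: $x^{[0]}=1$ and for $n\ge1$, $x^{[n]}=x(x+\tfrac n2-1)(x+\tfrac n2-2)\cdots(x-\tfrac n2+1)$. $S_2(n,k)$ denotes the Stirling numbers of the second kind, $\frac{1}{k!}(e^t-1)^k=\sum_{n\ge k}S_2(n,k)\frac{t^n}{n!}$. *)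

theory Defs
  imports
    Complex_Main
    "HOL-Combinatorics.Stirling"
    "HOL-Computational_Algebra.Formal_Power_Series"
    "HOL-Computational_Algebra.Polynomial"
begin

text \<open>The numbers \<open>S\<^sub>2(n, k)\<close> are the library's \<^const>\<open>Stirling\<close>, which is defined by recursion;
  they have the usual exponential generating function.\<close>

lemma Stirling_egf:
  "fps_const (1 / fact k) * (fps_exp 1 - 1) ^ k
     = Abs_fps (\<lambda>n. of_nat (Stirling n k) / fact n :: complex)"
proof (induction k)
  case 0
  have "Stirling n 0 = (if n = 0 then 1 else 0)" for n by (cases n) auto
  then show ?case by (auto simp: fps_eq_iff)
next
  case (Suc k)
  define E :: "complex fps" where "E = fps_exp 1 - 1"
  define F where "F = (\<lambda>k. fps_const (1 / fact k) * E ^ k)"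
  have dE: "fps_deriv E = E + 1" by (simp add: E_def)
  have E0: "fps_nth E 0 = 0" by (simp add: E_def)
  have c: "fps_const (1 / fact (Suc k)) * of_nat (Suc k) = fps_const (1 / fact k :: complex)"
    unfolding fps_of_nat[symmetric] by (simp add: field_simps del: of_nat_Suc)
  have "fps_deriv (F (Suc k)) =
          (fps_const (1 / fact (Suc k)) * of_nat (Suc k)) * E ^ k * (E + 1)"
    by (simp add: F_def fps_deriv_power dE fps_of_nat[symmetric] mult_ac
             del: fact_Suc of_nat_Suc power_Suc)
  also have "\<dots> = fps_const (1 / fact k) * E ^ Suc k + F k"
    unfolding c by (simp add: F_def algebra_simps)
  also have "fps_const (1 / fact k) * E ^ Suc k = of_nat (Suc k) * F (Suc k)"
    unfolding F_def c[symmetric] by (simp only: mult_ac)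
  finally have d: "fps_deriv (F (Suc k)) = of_nat (Suc k) * F (Suc k) + F k" .
  have F0: "fps_nth (F (Suc k)) 0 = 0" by (simp add: F_def E0)
  have IH: "fps_nth (F k) n = of_nat (Stirling n k) / fact n" for n
    using Suc.IH by (simp add: F_def E_def)
  have "fps_nth (F (Suc k)) n = of_nat (Stirling n (Suc k)) / fact n" for n
  proof (induction n)
    case 0
    show ?case by (simp add: F0)
  next
    case (Suc n)
    have "of_nat (Suc n) * fps_nth (F (Suc k)) (Suc n) = fps_nth (fps_deriv (F (Suc k))) n"
      by simp
    also have "\<dots> = of_nat (Suc k) * fps_nth (F (Suc k)) n + fps_nth (F k) n"
      unfolding d fps_of_nat[symmetric] by (simp del: of_nat_Suc)
    also have "\<dots> = of_nat (Stirling (Suc n) (Suc k)) / fact n"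
      unfolding IH Suc.IH by (simp add: add_divide_distrib ring_distribs)
    finally show ?case by (simp add: field_simps del: of_nat_Suc Stirling.simps)
  qed
  then show ?case by (simp add: F_def E_def fps_eq_iff)
qed

text \<open>The factors of \<open>x\<^sup>[\<^sup>n\<^sup>]\<close> other than \<open>x\<close> are \<open>x + n/2 - j\<close> for \<open>1 \<le> j \<le> n - 1\<close>.\<close>

definition central_factorial :: "nat \<Rightarrow> complex poly" where
  "central_factorial n =
     (if n = 0 then 1 else [:0, 1:] * (\<Prod>j=1..n-1. [:of_nat n / 2 - of_nat j, 1:]))"

text \<open>The expansion determines only the coefficients with \<open>k \<le> n\<close>; the others are set to \<open>0\<close>
  so that the coefficient function is unique.\<close>

definition T2 :: "(nat \<Rightarrow> complex poly) \<Rightarrow> nat \<Rightarrow> nat \<Rightarrow> complex" where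
  "T2 p n = (THE c. (\<forall>k>n. c k = 0) \<and> p n = (\<Sum>k\<le>n. smult (c k) (central_factorial k)))"

lemma degree_central_factorial: "degree (central_factorial n) = n"
proof -
  have "degree (\<Prod>j=1..n-1. [:of_nat n / 2 - of_nat j, 1 :: complex:]) = n - 1"
    by (subst degree_prod_eq_sum_degree) auto
  moreover have "(\<Prod>j=1..n-1. [:of_nat n / 2 - of_nat j, 1 :: complex:]) \<noteq> 0"
    by auto
  ultimately show ?thesis
    unfolding central_factorial_def by (auto simp: degree_mult_eq)
qed

lemma central_factorial_expansion_exists:
  assumes "degree q \<le> n"
  shows "\<exists>c. (\<forall>k>n. c k = 0) \<and> q = (\<Sum>k\<le>n. smult (c k) (central_factorial k))"
  using assms
proof (induction n arbitrary: q)
  case 0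
  then obtain a where "q = [:a:]" by (auto elim: degree_eq_zeroE)
  then show ?case
    by (intro exI[of _ "\<lambda>k. if k = 0 then a else 0"]) (auto simp: central_factorial_def)
next
  case (Suc n)
  let ?b = "central_factorial (Suc n)"
  define a where "a = coeff q (Suc n) / lead_coeff ?b"
  have nz: "lead_coeff ?b \<noteq> 0"
    using degree_central_factorial[of "Suc n"] by (metis degree_0 leading_coeff_neq_0 nat.distinct(1))
  have "degree (q - smult a ?b) \<le> n"
  proof (rule degree_le, intro allI impI)
    fix i assume "n < i"
    then consider "i = Suc n" | "i > Suc n" by linarith
    then show "coeff (q - smult a ?b) i = 0"
    proof cases
      case 1
      then show ?thesis using nz by (simp add: a_def degree_central_factorial)
    next
      case 2
      then show ?thesis using Suc.prems
        by (simp add: coeff_eq_0 degree_central_factorial)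
    qed
  qed
  from Suc.IH[OF this] obtain c where c: "\<forall>k>n. c k = 0"
    "q - smult a ?b = (\<Sum>k\<le>n. smult (c k) (central_factorial k))" by blast
  have "(\<Sum>k\<le>n. smult ((c(Suc n := a)) k) (central_factorial k))
          = (\<Sum>k\<le>n. smult (c k) (central_factorial k))"
    by (intro sum.cong) auto
  then have "q = (\<Sum>k\<le>Suc n. smult ((c(Suc n := a)) k) (central_factorial k))"
    using c(2) by (simp add: algebra_simps)
  then show ?case using c(1) by (intro exI[of _ "c(Suc n := a)"]) auto
qed

lemma central_factorial_independent:
  assumes "(\<Sum>k\<le>n. smult (c k) (central_factorial k)) = 0" "k \<le> n"
  shows "c k = 0"
  using assms
proof (induction n)
  case 0
  then show ?case by (simp add: central_factorial_def)
next
  case (Suc n)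
  let ?b = "central_factorial (Suc n)"
  have nz: "lead_coeff ?b \<noteq> 0"
    using degree_central_factorial[of "Suc n"] by (metis degree_0 leading_coeff_neq_0 nat.distinct(1))
  have "coeff (\<Sum>k\<le>n. smult (c k) (central_factorial k)) (Suc n) = 0"
    by (auto simp: coeff_sum coeff_eq_0 degree_central_factorial intro!: sum.neutral)
  then have "c (Suc n) * lead_coeff ?b = 0"
    using arg_cong[OF Suc.prems(1), of "\<lambda>q. coeff q (Suc n)"]
    by (simp add: degree_central_factorial)
  then have "c (Suc n) = 0" using nz by simp
  then show ?case using Suc by (cases "k = Suc n") auto
qed

lemma T2_unique_existence:
  assumes "degree (p n) = n"
  shows "\<exists>!c. (\<forall>k>n. c k = 0) \<and> p n = (\<Sum>k\<le>n. smult (c k) (central_factorial k))"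
proof (rule ex_ex1I)
  show "\<exists>c. (\<forall>k>n. c k = 0) \<and> p n = (\<Sum>k\<le>n. smult (c k) (central_factorial k))"
    using central_factorial_expansion_exists[of "p n" n] assms by simp
next
  fix c d
  assume c: "(\<forall>k>n. c k = 0) \<and> p n = (\<Sum>k\<le>n. smult (c k) (central_factorial k))"
    and d: "(\<forall>k>n. d k = 0) \<and> p n = (\<Sum>k\<le>n. smult (d k) (central_factorial k))"
  have "(\<Sum>k\<le>n. smult (c k - d k) (central_factorial k)) = 0"
    using c d by (simp add: smult_diff_left sum_subtractf)
  from central_factorial_independent[OF this] have "k \<le> n \<Longrightarrow> c k = d k" for k by simp
  then show "c = d" using c d by (metis ext not_le)
qed

lemma T2_expansion:
  assumes "degree (p n) = n"
  shows "p n = (\<Sum>k\<le>n. smult (T2 p n k) (central_factorial k))"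
  using theI'[OF T2_unique_existence[of p n, OF assms]] unfolding T2_def by blast

end

theory Submission
  imports Defs
begin

text \<open>A power series \<open>f\<close> acts on polynomials as the operator \<open>f(D)\<close>, \<open>D = d/dx\<close>, and this action is
  multiplicative. By the generating function of \<open>S\<^sub>2\<close>, the right-hand side is
  \<open>exp(-k D/2) (exp D - 1)\<^sup>k / k!\<close> applied to \<open>p\<^sub>n\<close> and evaluated at \<open>0\<close>, that is,
  \<open>\<delta>\<^sup>k p\<^sub>n(0) / k!\<close> for the central difference \<open>\<delta> = exp(D/2) - exp(-D/2)\<close>.
  Since \<open>\<delta> x\<^sup>[\<^sup>m\<^sup>] = m x\<^sup>[\<^sup>m\<^sup>-\<^sup>1\<^sup>]\<close>, this functional extracts the coefficient of \<open>x\<^sup>[\<^sup>k\<^sup>]\<close>.\<close>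

definition fps_pderiv :: "'a :: field_char_0 fps \<Rightarrow> 'a poly \<Rightarrow> 'a poly" where
  "fps_pderiv f q = (\<Sum>l\<le>degree q. smult (fps_nth f l) ((pderiv ^^ l) q))"

lemma higher_pderiv_eq_0:
  fixes q :: "'a :: field_char_0 poly"
  assumes "degree q < l"
  shows "(pderiv ^^ l) q = 0"
  using assms by (auto simp: poly_eq_iff coeff_higher_pderiv coeff_eq_0)

text \<open>Derivatives of order above \<open>degree q\<close> vanish, so the cutoff may be raised
  at will. This puts polynomials of different degrees under one summation range.\<close>

lemma fps_pderiv_eq:
  assumes "degree q \<le> N"
  shows "fps_pderiv f q = (\<Sum>l\<le>N. smult (fps_nth f l) ((pderiv ^^ l) q))"
  unfolding fps_pderiv_def using assms
  by (intro sum.mono_neutral_left) (auto simp: higher_pderiv_eq_0)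

lemma smult_sum_right: "smult c (sum f A) = (\<Sum>i\<in>A. smult c (f i))"
  by (induction A rule: infinite_finite_induct) (simp_all add: smult_add_right)

lemma fps_pderiv_add: "fps_pderiv f (q + r) = fps_pderiv f q + fps_pderiv f r"
proof -
  let ?N = "max (degree q) (degree r)"
  have "degree (q + r) \<le> ?N" by (rule degree_add_le_max)
  then show ?thesis
    by (simp add: fps_pderiv_eq[of _ ?N] higher_pderiv_add smult_add_right sum.distrib)
qed

lemma fps_pderiv_smult: "fps_pderiv f (smult c q) = smult c (fps_pderiv f q)"
  by (simp add: fps_pderiv_eq[of _ "degree q"] degree_smult_le higher_pderiv_smult
      smult_sum_right mult.commute)

lemma fps_pderiv_0_right [simp]: "fps_pderiv f 0 = 0"
  by (simp add: fps_pderiv_def)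

lemma fps_pderiv_sum: "fps_pderiv f (sum g A) = (\<Sum>i\<in>A. fps_pderiv f (g i))"
  by (induction A rule: infinite_finite_induct) (simp_all add: fps_pderiv_add)

lemma fps_pderiv_1 [simp]: "fps_pderiv 1 q = q"
proof -
  have "fps_pderiv 1 q = (\<Sum>l\<le>degree q. if l = 0 then q else 0)"
    unfolding fps_pderiv_def by (intro sum.cong) auto
  then show ?thesis by simp
qed

lemma fps_pderiv_diff_left: "fps_pderiv (f - g) q = fps_pderiv f q - fps_pderiv g q"
  by (simp add: fps_pderiv_def smult_diff_left sum_subtractf)

lemma degree_fps_pderiv_le: "degree (fps_pderiv f q) \<le> degree q"
  unfolding fps_pderiv_def
  by (intro degree_sum_le) (auto intro: order.trans[OF degree_smult_le] simp: degree_higher_pderiv)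

text \<open>Composing the operators gives a double sum over derivatives of order i + j; collecting
  the terms of equal order yields the Cauchy product.\<close>

lemma fps_pderiv_mult: "fps_pderiv (f * g) q = fps_pderiv f (fps_pderiv g q)"
proof -
  define N where "N = degree q"
  define t where "t i j = smult (fps_nth f i * fps_nth g j) ((pderiv ^^ (i + j)) q)" for i j
  have "fps_pderiv f (fps_pderiv g q)
      = (\<Sum>i\<le>N. smult (fps_nth f i) ((pderiv ^^ i) (fps_pderiv g q)))"
    by (intro fps_pderiv_eq) (simp add: N_def degree_fps_pderiv_le)
  also have "\<dots> = (\<Sum>i\<le>N. \<Sum>j\<le>N. t i j)"
    by (simp add: fps_pderiv_def higher_pderiv_sum higher_pderiv_smult smult_sum_right t_def
        funpow_add N_def)
  \<comment> \<open>Terms with i + j > N contain a derivative of order above the degree of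
    \<open>q\<close>, so the square shrinks to a triangle.\<close>
  also have "\<dots> = (\<Sum>i\<le>N. \<Sum>j\<le>N - i. t i j)"
    by (intro sum.cong refl sum.mono_neutral_right) (auto simp: t_def N_def higher_pderiv_eq_0)
  also have "\<dots> = (\<Sum>(i, j)\<in>{(i, j). i + j \<le> N}. t i j)"
    by (subst sum.Sigma) (auto intro!: sum.cong)
  also have "\<dots> = (\<Sum>l\<le>N. \<Sum>i\<le>l. t i (l - i))"
    by (rule sum.triangle_reindex_eq)
  also have "\<dots> = fps_pderiv (f * g) q"
    by (simp add: fps_pderiv_def N_def t_def fps_mult_nth smult_sum atMost_atLeast0)
  finally show ?thesis ..
qed

lemma higher_pderiv_pcompose_shift:
  "(pderiv ^^ l) (pcompose q [:a, 1:]) = pcompose ((pderiv ^^ l) q) [:a, 1:]"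
  for a :: "'a :: field_char_0"
  by (induction l) (simp_all add: pderiv_pcompose pderiv_pCons)

text \<open>This is Taylor's formula: exp(aD) is translation by a. The coefficients of q(X + x) are
  the Taylor coefficients of \<open>q\<close> at \<open>x\<close>, and evaluating at X = a gives the
  sum.\<close>

lemma poly_fps_pderiv_exp:
  fixes q :: "'a :: field_char_0 poly"
  shows "poly (fps_pderiv (fps_exp a) q) x = poly q (x + a)"
proof -
  define r where "r = pcompose q [:x, 1:]"
  have deg: "degree r = degree q" by (simp add: r_def degree_pcompose)
  have "fact l * coeff r l = poly ((pderiv ^^ l) q) x" for l
  proof -
    have "fact l * coeff r l = poly ((pderiv ^^ l) r) 0"
      by (simp add: poly_0_coeff_0 coeff_higher_pderiv pochhammer_fact)
    then show ?thesis by (simp add: r_def higher_pderiv_pcompose_shift poly_pcompose)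
  qed
  then have c: "coeff r l = poly ((pderiv ^^ l) q) x / fact l" for l
    by (metis fact_nonzero nonzero_mult_div_cancel_left)
  have "poly q (x + a) = poly r a" by (simp add: r_def poly_pcompose)
  also have "\<dots> = (\<Sum>l\<le>degree q. poly ((pderiv ^^ l) q) x / fact l * a ^ l)"
    by (simp add: poly_altdef deg c)
  also have "\<dots> = poly (fps_pderiv (fps_exp a) q) x"
    by (simp add: fps_pderiv_def poly_sum field_simps)
  finally show ?thesis ..
qed

definition central_diff :: "'a :: field_char_0 fps" where
  "central_diff = fps_exp (1 / 2) - fps_exp (- 1 / 2)"

lemma poly_central_factorial_Suc:
  "poly (central_factorial (Suc n)) x = x * (\<Prod>j=1..n. x + of_nat (Suc n) / 2 - of_nat j)"
  by (simp add: central_factorial_def poly_prod algebra_simps)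

lemma central_diff_central_factorial_0: "fps_pderiv central_diff (central_factorial 0) = 0"
  by (simp add: central_diff_def fps_pderiv_diff_left fps_pderiv_def central_factorial_def)

text \<open>Both translates by 1/2 and -1/2 share all but two of their linear factors, and (x +
  1/2)(x + n/2) - (x - 1/2)(x - n/2) = (n + 1) x.\<close>

lemma central_diff_central_factorial_Suc:
  "fps_pderiv central_diff (central_factorial (Suc n))
     = smult (of_nat (Suc n)) (central_factorial n)"
proof (rule poly_ext)
  fix x :: complex
  have "poly (fps_pderiv central_diff (central_factorial (Suc n))) x
      = poly (central_factorial (Suc n)) (x + 1 / 2) - poly (central_factorial (Suc n)) (x - 1 / 2)"
    by (simp add: central_diff_def fps_pderiv_diff_left poly_fps_pderiv_exp del: of_nat_Suc)
  also have "\<dots> = (x + 1 / 2) * (\<Prod>j=1..n. x + of_nat n / 2 + 1 - of_nat j)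
      - (x - 1 / 2) * (\<Prod>j=1..n. x + of_nat n / 2 - of_nat j)"
    unfolding poly_central_factorial_Suc
    by (intro arg_cong2[of _ _ _ _ "(-)"] arg_cong2[of _ _ _ _ "(*)"] prod.cong refl)
      (simp_all add: field_simps)
  also have "\<dots> = of_nat (Suc n) * poly (central_factorial n) x"
  \<comment> \<open>For n = 0 the central factorial is 1, which lacks the factor x, so this case
    stands apart.\<close>
  proof (cases n)
    case 0
    then show ?thesis by (simp add: central_factorial_def)
  next
    case (Suc m)
    \<comment> \<open>\<open>P\<close> is the common factor of the two translates: the
      \<open>n\<close>-th central factorial without its factor x.\<close>
    define P where "P = (\<Prod>j=1..m. x + of_nat n / 2 - of_nat j)"
    have "(\<Prod>j=1..n. x + of_nat n / 2 + 1 - of_nat j)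
        = (\<Prod>j=0..m. x + of_nat n / 2 - of_nat j)"
      unfolding Suc by (rule prod.reindex_bij_witness[of _ Suc "\<lambda>j. j - 1"]) (auto simp: of_nat_diff)
    also have "\<dots> = (x + of_nat n / 2) * P"
      by (simp add: prod.atLeast_Suc_atMost P_def)
    finally have 1: "(\<Prod>j=1..n. x + of_nat n / 2 + 1 - of_nat j) = (x + of_nat n / 2) * P" .
    have "(\<Prod>j=1..n. x + of_nat n / 2 - of_nat j) = P * (x + of_nat n / 2 - of_nat n)"
      unfolding P_def by (simp add: Suc)
    then have 2: "(\<Prod>j=1..n. x + of_nat n / 2 - of_nat j) = P * (x - of_nat n / 2)"
      by (simp add: field_simps)
    have 3: "poly (central_factorial n) x = x * P"
      unfolding P_def Suc by (rule poly_central_factorial_Suc)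
    show ?thesis unfolding 1 2 3 by (simp add: field_simps)
  qed
  finally show "poly (fps_pderiv central_diff (central_factorial (Suc n))) x
      = poly (smult (of_nat (Suc n)) (central_factorial n)) x" by simp
qed

text \<open>Each application lowers the index by one and multiplies by the old index. At 0 only the
  central factorial of index 0 survives, which is reached after k steps exactly when m = k.\<close>

lemma poly_central_diff_power_central_factorial:
  "poly (fps_pderiv (central_diff ^ k) (central_factorial m)) 0 = (if m = k then fact k else 0)"
proof (induction k arbitrary: m)
  case 0
  show ?case by (cases m) (simp_all add: central_factorial_def)
next
  case (Suc k)
  \<comment> \<open>The innermost factor is split off, so the induction hypothesis is needed at
    index m - 1.\<close>
  have "fps_pderiv (central_diff ^ Suc k) (central_factorial m)
      = fps_pderiv (central_diff ^ k) (fps_pderiv central_diff (central_factorial m))"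
    by (simp add: power_Suc2 fps_pderiv_mult del: power_Suc)
  then show ?case
    by (cases m) (simp_all add: central_diff_central_factorial_0 central_diff_central_factorial_Suc
        fps_pderiv_smult Suc.IH del: of_nat_Suc)
qed

text \<open>The factor exp(-kD/2) is what moves the evaluation point from 0 to -k/2.\<close>

lemma central_diff_power:
  "central_diff ^ k = fps_exp (- of_nat k / 2) * (fps_exp 1 - 1 :: 'a :: field_char_0 fps) ^ k"
proof -
  have "fps_exp (1 / 2 :: 'a) = fps_exp (- 1 / 2) * fps_exp 1"
    by (simp flip: fps_exp_add_mult)
  then have *: "central_diff = fps_exp (- 1 / 2 :: 'a) * (fps_exp 1 - 1)"
    by (simp add: central_diff_def algebra_simps)
  show ?thesis
    unfolding * power_mult_distrib fps_exp_power_mult by simp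
qed

theorem theorem3p1:
  fixes p :: "nat \<Rightarrow> complex poly" and n k :: nat
  assumes "\<And>m. degree (p m) = m"
    and "p 0 = 1"
    and "k \<le> n"
  shows "T2 p n k =
    (\<Sum>l=k..n. of_nat (Stirling l k) * (1 / fact l) *
       poly ((pderiv ^^ l) (p n)) (- of_nat k / 2))"
proof -
  define E :: "complex fps" where "E = (fps_exp 1 - 1) ^ k"
  have S: "of_nat (Stirling l k) * (1 / fact l) = fps_nth E l / fact k" for l
    using arg_cong[OF Stirling_egf[of k], of "\<lambda>f. fps_nth f l"] by (simp add: E_def)
  \<comment> \<open>The added terms with l < k vanish because \<open>Stirling l k\<close> is 0
    there; the full range matches \<open>fps_pderiv\<close>.\<close>
  have "(\<Sum>l=k..n. of_nat (Stirling l k) * (1 / fact l) *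
          poly ((pderiv ^^ l) (p n)) (- of_nat k / 2))
      = (\<Sum>l\<le>n. of_nat (Stirling l k) * (1 / fact l) *
          poly ((pderiv ^^ l) (p n)) (- of_nat k / 2))"
    by (intro sum.mono_neutral_left) auto
  \<comment> \<open>The point is written as a translate of 0 so that
    \<open>poly_fps_pderiv_exp\<close>, read from right to left, applies.\<close>
  also have "\<dots> = poly (fps_pderiv E (p n)) (0 + - of_nat k / 2) / fact k"
    unfolding S by (simp add: fps_pderiv_def assms(1) poly_sum sum_divide_distrib)
  also have "\<dots> = poly (fps_pderiv (central_diff ^ k) (p n)) 0 / fact k"
    by (simp only: central_diff_power fps_pderiv_mult E_def poly_fps_pderiv_exp)
  \<comment> \<open>Expanding \<open>p n\<close> in central factorials, the functional kills every
    term but m = k, where \<open>fact k\<close> cancels.\<close>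
  also have "\<dots> = (\<Sum>m\<le>n. if m = k then T2 p n m else 0)"
    by (subst T2_expansion[OF assms(1)], simp add: fps_pderiv_sum fps_pderiv_smult poly_sum sum_divide_distrib
        poly_central_diff_power_central_factorial if_distrib cong: if_cong)
  also have "\<dots> = T2 p n k" using assms(3) by simp
  finally show ?thesis ..
qed

end
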